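(* Let $n\ge1$, $G=\mathbb F_2^n$, $B\subseteq G$, $K\ge1$, and $\eta\in[0,1)$, and suppose that $\mathfrak A(B;K,\eta)\ne\varnothing$. Then there is a subspace $V_{B,K,\eta}\le G$ such that, simultaneously for every $A\in\mathfrak A(B;K,\eta)$, $$|V_{B,K,\eta}|\le|A|\qquad\text{and}\qquad \mathcal N_{V_{B,K,\eta}}(A)\le\frac{2K}{1-\eta}P_{\rm PFR}(K).$$
   Context: For $S,T\subseteq\mathbb F_2^n$, $S+T=\{s+t:s\in S,t\in T\}$; $\triangle$ is symmetric difference. For a subspace $V$ and a set $S$, $\mathcal N_V(S)=\min\{|T|:S\subseteq T+V\}$ is the minimum number of $V$-cosets needed to cover $S$. Compatibility class: $\mathfrak A(B;K,\eta)=\{A\subseteq\mathbb F_2^n: A\ne\varnothing,\ |A+A|\le K|A|,\ |A\triangle B|\le\eta|A|\}$. $P_{\rm PFR}:[1,\infty)\to[1,\infty)$ is a nondecreasing polynomial, fixed once and for all together with a nondecreasing computable function $F_{\rm PFR}$, having the following property (size-oblivious algorithmic PFR): there is a randomized algorithm which, given $K\ge1$, $\rho\in(0,1)$, deterministic membership access to a nonempty $A\subseteq\mathbb F_2^n$ with $|A+A|\le K|A|$, and independent exact uniform samples from $A$ (but not $|A|$), outputs with probability at least $1-\rho$ a basis of a subspace $V\le\mathbb F_2^n$ with $|V|\le|A|$ and $\mathcal N_V(A)\le P_{\rm PFR}(K)$, using $O(n+\log(1/\rho))$ samples and at most $F_{\rm PFR}(K)\operatorname{poly}(n,\log(1/\rho))$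 membership queries and running time. In particular, every nonempty $A\subseteq\mathbb F_2^n$ with $|A+A|\le K|A|$ admits a subspace $V$ with $|V|\le|A|$ and $\mathcal N_V(A)\le P_{\rm PFR}(K)$. *)

theory Defs
  imports
    Complex_Main
    "HOL-Computational_Algebra.Polynomial"
    "HOL-Library.Z2"
    "HOL-Library.Function_Algebras"
    "HOL-Library.Set_Algebras"
begin

text \<open>
  The group \<open>F_2^n\<close>, for a dimension \<open>n\<close> that is an ordinary natural number (the PFR property
  below quantifies over it): sequences over the two-element field \<^typ>\<open>bit\<close> that vanish from
  index \<open>n\<close> on. Addition is pointwise, and the sumset \<open>S + T\<close> is that of
  \<^theory>\<open>HOL-Library.Set_Algebras\<close>.
\<close>

definition F2 :: "nat \<Rightarrow> (nat \<Rightarrow> bit) set" where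
  "F2 n = {x. \<forall>i\<ge>n. x i = 0}"

definition scale_bit :: "bit \<Rightarrow> (nat \<Rightarrow> bit) \<Rightarrow> (nat \<Rightarrow> bit)" where
  "scale_bit c x = (\<lambda>i. c * x i)"

interpretation bitvec: vector_space scale_bit
  by unfold_locales (auto simp: scale_bit_def fun_eq_iff algebra_simps)

definition subspace_F2 :: "nat \<Rightarrow> (nat \<Rightarrow> bit) set \<Rightarrow> bool" where
  "subspace_F2 n V \<longleftrightarrow> V \<subseteq> F2 n \<and> bitvec.subspace V"

text \<open>
  The covering number \<open>N_V(S)\<close>. For \<open>S \<subseteq> F2 n\<close> and \<open>V\<close> a subspace of \<open>F2 n\<close>, the minimum is over
  a finite nonempty set of numbers (\<open>T = S\<close> is admissible).
\<close>

definition cover_num :: "nat \<Rightarrow> (nat \<Rightarrow> bit) set \<Rightarrow> (nat \<Rightarrow> bit) set \<Rightarrow> nat" where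
  "cover_num n V S = Min {card T | T. T \<subseteq> F2 n \<and> S \<subseteq> T + V}"

definition compat_class ::
  "nat \<Rightarrow> (nat \<Rightarrow> bit) set \<Rightarrow> real \<Rightarrow> real \<Rightarrow> (nat \<Rightarrow> bit) set set" where
  "compat_class n B K \<eta> =
     {A. A \<subseteq> F2 n \<and> A \<noteq> {} \<and> real (card (A + A)) \<le> K * real (card A) \<and>
         real (card ((A - B) \<union> (B - A))) \<le> \<eta> * real (card A)}"

text \<open>
  \<open>P\<close> is an admissible choice of \<open>P_PFR\<close>: a polynomial that maps \<open>[1,\<infinity>)\<close> to itself, is nondecreasing
  there, and bounds the covering number in the polynomial Freiman--Ruzsa theorem, in every dimension
  and for every doubling constant. Only this existence statement is demanded. The algorithm whose
  outputs witness it, and its resource bounds, are not, so every polynomial that comes with such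
  an algorithm is admissible.
\<close>

definition PFR_polynomial :: "real poly \<Rightarrow> bool" where
  "PFR_polynomial P \<longleftrightarrow>
     (\<forall>x\<ge>1. 1 \<le> poly P x) \<and> mono_on {1..} (poly P) \<and>
     (\<forall>n\<ge>1. \<forall>K\<ge>1. \<forall>A. A \<subseteq> F2 n \<longrightarrow> A \<noteq> {} \<longrightarrow> real (card (A + A)) \<le> K * real (card A) \<longrightarrow>
        (\<exists>V. subspace_F2 n V \<and> card V \<le> card A \<and> real (cover_num n V A) \<le> poly P K))"

end

theory Submission
  imports Defs
begin

text \<open>
  Take for \<open>V\<close> a PFR subspace of a member \<open>A\<^sub>0\<close> of the class of minimal cardinality. Any other
  member \<open>A\<close> meets \<open>A\<^sub>0\<close> in at least \<open>(1 - \<eta>)|A| / 2\<close> points, because both are close to \<open>B\<close>. By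
  pigeonhole some \<open>V\<close>-coset contains a set \<open>J \<subseteq> A \<inter> A\<^sub>0\<close> of at least \<open>|A \<inter> A\<^sub>0| / P(K)\<close> points.
  The translates of \<open>J\<close> by representatives of the \<open>V\<close>-cosets meeting \<open>A\<close> are disjoint subsets of
  \<open>A + A\<close>, so there are at most \<open>K|A| / |J|\<close> such cosets.
\<close>

text \<open>A vector over \<open>bit\<close> is determined by its support, which here is a subset of
  \<open>{..<n}\<close>.\<close>

lemma finite_F2: "finite (F2 n)"
proof (rule finite_imageD)
  have "(\<lambda>x. {i. x i = 1}) ` F2 n \<subseteq> Pow {..<n}"
  proof (intro image_subsetI PowI subsetI)
    fix x i assume "x \<in> F2 n" "i \<in> {i. x i = 1}"
    then have "\<not> n \<le> i" unfolding F2_def by auto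
    then show "i \<in> {..<n}" by simp
  qed
  then show "finite ((\<lambda>x. {i. x i = 1}) ` F2 n)"
    by (rule finite_subset) simp
  show "inj_on (\<lambda>x. {i. x i = 1}) (F2 n)"
  proof (rule inj_onI, rule ext)
    fix x y :: "nat \<Rightarrow> bit" and i
    assume "{i. x i = 1} = {i. y i = 1}"
    then have "x i = 1 \<longleftrightarrow> y i = 1" by blast
    then show "x i = y i" by (cases "x i"; cases "y i") auto
  qed
qed

lemma finite_cover_cards: "finite {card T | T. T \<subseteq> F2 n \<and> S \<subseteq> T + V}"
  by (rule finite_subset[of _ "card ` Pow (F2 n)"]) (auto simp: finite_F2)

lemma cover_num_le:
  assumes "T \<subseteq> F2 n" "S \<subseteq> T + V"
  shows "cover_num n V S \<le> card T"
  unfolding cover_num_def by (rule Min_le) (use finite_cover_cards assms in auto)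

lemma cover_num_attained:
  assumes "S \<subseteq> F2 n" "0 \<in> V"
  obtains T where "T \<subseteq> F2 n" "S \<subseteq> T + V" "card T = cover_num n V S"
proof -
  have "S \<subseteq> S + V"
  proof
    fix x assume "x \<in> S"
    then have "x + 0 \<in> S + V" using assms(2) by (rule set_plus_intro)
    then show "x \<in> S + V" by (simp only: add_0_right)
  qed
  then have "cover_num n V S \<in> {card T | T. T \<subseteq> F2 n \<and> S \<subseteq> T + V}"
    unfolding cover_num_def by (intro Min_in finite_cover_cards) (use assms(1) in auto)
  then show thesis using that by auto
qed

text \<open>The covering step. The hypothesis on differences puts \<open>J\<close> inside a single
  coset of \<open>V\<close>, so translating \<open>J\<close> by elements of distinct cosets gives
  disjoint sets. One representative in \<open>A\<close> per coset that meets \<open>A\<close> both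
  covers \<open>A\<close> and yields such translates inside \<open>A + J\<close>.\<close>

lemma cover_num_mult_le:
  assumes A: "A \<subseteq> F2 n" and V: "bitvec.subspace V"
    and J: "J \<subseteq> F2 n" "\<And>x y. x \<in> J \<Longrightarrow> y \<in> J \<Longrightarrow> x - y \<in> V"
  shows "cover_num n V A * card J \<le> card (A + J)"
proof -
  \<comment> \<open>The chosen predicate depends on \<open>a\<close> only through its coset, so
    congruent elements get literally the same representative.\<close>
  define r where "r a = (SOME y. y \<in> A \<and> y - a \<in> V)" for a
  have r: "r a \<in> A \<and> r a - a \<in> V" if "a \<in> A" for a
    unfolding r_def
  proof (rule someI[of _ a])
    show "a \<in> A \<and> a - a \<in> V"
      unfolding diff_self using that bitvec.subspace_0[OF V] by (rule conjI)
  qed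
  have r_cong: "r a = r b" if "a - b \<in> V" for a b
  proof -
    have "y - a \<in> V \<longleftrightarrow> y - b \<in> V" for y
      using bitvec.subspace_add[OF V _ that, of "y - a"] bitvec.subspace_diff[OF V _ that, of "y - b"]
      by auto
    then show ?thesis unfolding r_def by simp
  qed
  have X: "r ` A \<subseteq> A" using r by blast
  have "A \<subseteq> r ` A + V"
  proof
    fix a assume "a \<in> A"
    then have "a - r a \<in> V"
      using r bitvec.subspace_neg[OF V, of "r a - a"] by simp
    then show "a \<in> r ` A + V"
      using set_plus_intro[of "r a" "r ` A" "a - r a" V] \<open>a \<in> A\<close> by simp
  qed
  then have "cover_num n V A \<le> card (r ` A)"
    using X A by (intro cover_num_le) auto
  moreover have "card (r ` A) * card J \<le> card (A + J)"
  proof -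
    have "inj_on (\<lambda>(x, j). x + j) (r ` A \<times> J)"
    proof (intro inj_onI, clarsimp)
      fix a b j k
      assume *: "a \<in> A" "b \<in> A" "j \<in> J" "k \<in> J" and eq: "r a + j = r b + k"
      \<comment> \<open>A collision of two translates forces the representatives into one coset;
        since \<open>r\<close> fixes representatives, they are then equal, and cancellation gives
        \<open>j = k\<close>.\<close>
      have "r a - r b = k - j" using eq by (simp add: algebra_simps)
      then have "r a - r b \<in> V" using J(2) * by simp
      then have "r (r a) = r (r b)" by (rule r_cong)
      moreover have "r (r a) = r a" "r (r b) = r b" using r_cong r * by auto
      ultimately show "r a = r b \<and> j = k" using eq by simp
    qed
    moreover have "(\<lambda>(x, j). x + j) ` (r ` A \<times> J) \<subseteq> A + J"
      using X by (auto simp: set_plus_def)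
    moreover have "finite (A + J)"
      using finite_subset[OF A finite_F2] finite_subset[OF J(1) finite_F2]
      by (rule finite_set_plus)
    ultimately show ?thesis
      by (metis card_inj_on_le card_cartesian_product)
  qed
  ultimately show ?thesis
    by (meson le_trans mult_le_mono1)
qed

text \<open>Pigeonhole: a minimal cover of \<open>S\<close> also covers \<open>I\<close>, and
  \<open>J\<close> is the part of \<open>I\<close> in the fullest coset.\<close>

lemma exists_large_coset_piece:
  assumes "S \<subseteq> F2 n" and V: "bitvec.subspace V" and "I \<subseteq> S"
  obtains J where "J \<subseteq> I" "\<And>x y. x \<in> J \<Longrightarrow> y \<in> J \<Longrightarrow> x - y \<in> V"
    "card I \<le> cover_num n V S * card J"
\<comment> \<open>For empty \<open>I\<close> the cover \<open>T\<close> may be empty too, and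
  \<open>Max\<close> below would range over the empty set.\<close>
proof (cases "I = {}")
  case True
  then show thesis using that[of "{}"] by simp
next
  case False
  obtain T where T: "T \<subseteq> F2 n" "S \<subseteq> T + V" "card T = cover_num n V S"
    using cover_num_attained assms(1) bitvec.subspace_0[OF V] by blast
  define J where "J t = {x \<in> I. x - t \<in> V}" for t
  have finT: "finite T" using T(1) finite_F2 finite_subset by blast
  have finI: "finite I" using assms finite_F2 finite_subset by meson
  have cov: "I \<subseteq> (\<Union>t\<in>T. J t)"
  proof
    fix x assume "x \<in> I"
    then have "x \<in> T + V" using T(2) assms(3) by blast
    then obtain t v where "t \<in> T" "v \<in> V" "x = t + v" by (rule set_plus_elim)
    then show "x \<in> (\<Union>t\<in>T. J t)" using \<open>x \<in> I\<close> by (auto simp: J_def intro!: bexI[of _ t])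
  qed
  then have "T \<noteq> {}" using False by auto
  have "card I \<le> card (\<Union>t\<in>T. J t)"
    by (rule card_mono[OF _ cov]) (use finT finI in \<open>auto simp: J_def\<close>)
  also have "\<dots> \<le> (\<Sum>t\<in>T. card (J t))" by (rule card_UN_le[OF finT])
  also have "\<dots> \<le> card T * Max ((\<lambda>t. card (J t)) ` T)"
    using sum_bounded_above[of T "\<lambda>t. card (J t)" "Max ((\<lambda>t. card (J t)) ` T)"] finT by simp
  finally have le: "card I \<le> cover_num n V S * Max ((\<lambda>t. card (J t)) ` T)" using T(3) by simp
  have "Max ((\<lambda>t. card (J t)) ` T) \<in> (\<lambda>t. card (J t)) ` T"
    using finT \<open>T \<noteq> {}\<close> by (intro Max_in) auto
  then obtain t where t: "Max ((\<lambda>t. card (J t)) ` T) = card (J t)" by (rule imageE)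
  show thesis
  proof (rule that[of "J t"])
    show "J t \<subseteq> I" by (auto simp: J_def)
    show "x - y \<in> V" if "x \<in> J t" "y \<in> J t" for x y
      using bitvec.subspace_diff[OF V, of "x - t" "y - t"] that by (simp add: J_def)
    show "card I \<le> cover_num n V S * card (J t)" using le t by simp
  qed
qed

text \<open>A point of \<open>A\<close> outside \<open>A'\<close> lies in \<open>A - B\<close> or in
  \<open>B - A'\<close>. Adding this count to the one with \<open>A\<close> and \<open>A'\<close>
  exchanged regroups the four differences into the two symmetric differences with
  \<open>B\<close>.\<close>

lemma card_Int_of_close:
  fixes \<eta> :: real
  assumes fin: "finite A" "finite A'" "finite B"
    and A: "real (card ((A - B) \<union> (B - A))) \<le> \<eta> * real (card A)"
    and A': "real (card ((A' - B) \<union> (B - A'))) \<le> \<eta> * real (card A')"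
  shows "(1 - \<eta>) * (real (card A) + real (card A')) \<le> 2 * real (card (A \<inter> A'))"
proof -
  have sd: "card ((S - B) \<union> (B - S)) = card (S - B) + card (B - S)" if "finite S" for S
    using that fin(3) by (intro card_Un_disjoint) auto
  have le: "card S \<le> card (S \<inter> S') + card (S - B) + card (B - S')"
    if "finite S" "finite S'" for S S'
  proof -
    have "card S \<le> card ((S \<inter> S') \<union> (S - B) \<union> (B - S'))"
      by (rule card_mono) (use that fin(3) in auto)
    also have "\<dots> \<le> card ((S \<inter> S') \<union> (S - B)) + card (B - S')" by (rule card_Un_le)
    also have "\<dots> \<le> card (S \<inter> S') + card (S - B) + card (B - S')"
      using card_Un_le[of "S \<inter> S'" "S - B"] by simp
    finally show ?thesis .
  qed
  have "card A + card A' \<le> 2 * card (A \<inter> A')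
      + (card (A - B) + card (B - A)) + (card (A' - B) + card (B - A'))"
    using le[OF fin(1,2)] le[OF fin(2,1)] by (simp add: Int_commute)
  then have "real (card A) + real (card A') \<le> 2 * real (card (A \<inter> A'))
      + real (card (A - B) + card (B - A)) + real (card (A' - B) + card (B - A'))"
    by linarith
  then show ?thesis
    using A A' unfolding sd[OF fin(1)] sd[OF fin(2)] by (simp add: algebra_simps)
qed

theorem theorem2p6:
  fixes P_PFR :: "real poly" and n :: nat and B :: "(nat \<Rightarrow> bit) set" and K \<eta> :: real
  assumes "PFR_polynomial P_PFR"
    and "n \<ge> 1" and "B \<subseteq> F2 n" and "K \<ge> 1" and "0 \<le> \<eta>" and "\<eta> < 1"
    and "compat_class n B K \<eta> \<noteq> {}"
  shows "\<exists>V. subspace_F2 n V \<and>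
           (\<forall>A \<in> compat_class n B K \<eta>.
              card V \<le> card A \<and>
              real (cover_num n V A) \<le> 2 * K / (1 - \<eta>) * poly P_PFR K)"
proof -
  let ?C = "compat_class n B K \<eta>"
  \<comment> \<open>PFR bounds \<open>card V\<close> by \<open>card A0\<close> only; minimality
    passes this bound to every member of the class.\<close>
  obtain A0 where A0: "A0 \<in> ?C" and least: "\<And>A. A \<in> ?C \<Longrightarrow> card A0 \<le> card A"
    using ex_has_least_nat[of "\<lambda>A. A \<in> ?C" _ card] assms(7) by blast
  have A0': "A0 \<subseteq> F2 n" "A0 \<noteq> {}" "real (card (A0 + A0)) \<le> K * real (card A0)"
    "real (card ((A0 - B) \<union> (B - A0))) \<le> \<eta> * real (card A0)"
    using A0 by (auto simp: compat_class_def)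
  obtain V where V: "subspace_F2 n V" "card V \<le> card A0" "real (cover_num n V A0) \<le> poly P_PFR K"
    using assms(1,2,4) A0'(1-3) unfolding PFR_polynomial_def by blast
  then have sub: "bitvec.subspace V" by (simp add: subspace_F2_def)
  have "real (cover_num n V A) \<le> 2 * K / (1 - \<eta>) * poly P_PFR K" if "A \<in> ?C" for A
  proof -
    have A: "A \<subseteq> F2 n" "A \<noteq> {}" "real (card (A + A)) \<le> K * real (card A)"
      "real (card ((A - B) \<union> (B - A))) \<le> \<eta> * real (card A)"
      using that by (auto simp: compat_class_def)
    have fin: "finite A" "finite A0" "finite B"
      using A(1) A0'(1) assms(3) finite_F2 finite_subset by blast+
    have pos: "card A > 0" using fin(1) A(2) by (simp add: card_gt_0_iff)
    obtain J where J: "J \<subseteq> A \<inter> A0" "\<And>x y. x \<in> J \<Longrightarrow> y \<in> J \<Longrightarrow> x - y \<in> V"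
      "card (A \<inter> A0) \<le> cover_num n V A0 * card J"
      using exists_large_coset_piece[OF A0'(1) sub, of "A \<inter> A0"] by blast
    have "cover_num n V A * card J \<le> card (A + J)"
      using J(1,2) A(1) by (intro cover_num_mult_le[OF A(1) sub]) auto
    also have "\<dots> \<le> card (A + A)"
      using J(1) fin(1) by (intro card_mono finite_set_plus set_plus_mono2) auto
    finally have "real (cover_num n V A) * real (card J) \<le> K * real (card A)"
      using A(3) by (metis of_nat_le_iff of_nat_mult order_trans)
    moreover have "0 \<le> poly P_PFR K" using V(3) by linarith
    ultimately have 1: "poly P_PFR K * (real (cover_num n V A) * real (card J))
        \<le> poly P_PFR K * (K * real (card A))"
      by (rule mult_left_mono)
    have "(1 - \<eta>) * (real (card A) + real (card A0)) \<le> 2 * real (card (A \<inter> A0))"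
      by (rule card_Int_of_close[OF fin A(4) A0'(4)])
    \<comment> \<open>Discarding the \<open>A0\<close> term leaves an overlap of at least half of
      \<open>(1 - \<eta>) * card A\<close>, the source of the factor 2 in the final bound.\<close>
    moreover have "(1 - \<eta>) * real (card A0) \<ge> 0" using assms(6) by simp
    ultimately have "(1 - \<eta>) * real (card A) \<le> 2 * real (card (A \<inter> A0))"
      by (simp add: distrib_left)
    also have "real (card (A \<inter> A0)) \<le> real (cover_num n V A0) * real (card J)"
      using J(3) by (metis of_nat_le_iff of_nat_mult)
    also have "\<dots> \<le> poly P_PFR K * real (card J)"
      using V(3) by (intro mult_right_mono) auto
    finally have 2: "(1 - \<eta>) * real (card A) \<le> 2 * (poly P_PFR K * real (card J))" by simp
    \<comment> \<open>The upper bound on \<open>cover_num n V A * card J\<close> and the lower bound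
      on \<open>card J\<close> are chained as products, so \<open>card J\<close> is eliminated
      without division; only \<open>card A > 0\<close> and \<open>1 - \<eta> > 0\<close> are divided
      out.\<close>
    have "real (cover_num n V A) * ((1 - \<eta>) * real (card A))
        \<le> real (cover_num n V A) * (2 * (poly P_PFR K * real (card J)))"
      using 2 by (rule mult_left_mono) simp
    also have "\<dots> \<le> 2 * (poly P_PFR K * (K * real (card A)))"
      using 1 by (simp add: mult_ac)
    finally have "(real (cover_num n V A) * (1 - \<eta>)) * real (card A)
        \<le> (2 * K * poly P_PFR K) * real (card A)"
      by (simp add: mult_ac)
    then have "real (cover_num n V A) * (1 - \<eta>) \<le> 2 * K * poly P_PFR K"
      using pos by (simp add: mult_le_cancel_right)
    then show ?thesis using assms(6) by (simp add: pos_le_divide_eq)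
  qed
  then show ?thesis
    using V(1,2) least order_trans by blast
qed

end
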